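(* Let $m,p,L,N,T\in\mathbb{Z}_{\ge0}$ and let $\mathcal{B}^*\in\mathsf{LTI}^{m,p}$ satisfy $\ell(\mathcal{B}^* )\le L$ and $n(\mathcal{B}^* )\le N$. Let $(u,y)\in\mathcal{B}^*_{[0,T-1]}$. Then, for all integers $k$ with $1\le k\le T$, $$\operatorname{im}\begin{pmatrix} \mathcal{H}_k(u) \\ \mathcal{H}_k(y) \end{pmatrix}\subseteq\bigcap_{\mathcal{B}\in\Sigma(u,y)}\mathcal{B}_{[0,k-1]}.$$
   Context: **Behaviors.** Consider linear time-invariant systems $x(t+1)=Ax(t)+Bu(t)$, $y(t)=Cx(t)+Du(t)$, $t\in\mathbb{Z}_{\ge0}$, with real matrices $A\in\mathbb{R}^{n\times n}$, $B\in\mathbb{R}^{n\times m}$, $C\in\mathbb{R}^{p\times n}$, $D\in\mathbb{R}^{p\times m}$ ($n\in\mathbb{Z}_{\ge0}$; $n=0$ means a static system $y=Du$). The behavior of the system is $\mathcal{B}=\{(u,y)\in(\mathbb{R}^m)^{\mathbb{Z}_{\ge0}}\times(\mathbb{R}^p)^{\mathbb{Z}_{\ge0}} \mid \exists x\in(\mathbb{R}^n)^{\mathbb{Z}_{\ge0}}$ such that the system equations hold for all $t\in\mathbb{Z}_{\ge0}\}$; the system is called a state-space representation of $\mathcal{B}$. $\mathsf{LTI}^{m,p}$ is the set of all such behaviors with $m$ inputs and $p$ outputs (any $n$). $n(\mathcal{B})$ is the smallest state dimension among all state-space representations of $\mathcal{B}$; a representation attaining it is minimal. With $\mathcal{O}_0$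 the $0\times n$ void matrix (rank $0$) and $\mathcal{O}_k=\begin{pmatrix} C \\ C A \\ \vdots \\ C A^{k-1} \end{pmatrix}$ for $k>0$, the lag is $\ell(\mathcal{B})=\min\{k\in\mathbb{Z}_{\ge0}\mid \operatorname{rank}\mathcal{O}_k=\operatorname{rank}\mathcal{O}_{k+1}\}$, computed from a minimal representation of $\mathcal{B}$. **Restrictions.** $w_{[t_0,t_1]}=(w(t_0),\dots,w(t_1))$ is a stacked column vector, and $\mathcal{B}_{[t_0,t_1]}=\{(u_{[t_0,t_1]},y_{[t_0,t_1]})\mid(u,y)\in\mathcal{B}\}$, viewed as a subset of $\mathbb{R}^{(m+p)(t_1-t_0+1)}$ with all input samples stacked above all output samples. **Explaining systems.** $\mathcal{M}=\{\mathcal{B}\in\mathsf{LTI}^{m,p}\mid \ell(\mathcal{B})\le L,\ n(\mathcal{B})\le N\}$, and $\Sigma(u,y)=\{\mathcal{B}\in\mathcal{M}\mid(u,y)\in\mathcal{B}_{[0,T-1]}\}$ for a pair $(u,y)$ of length $T$. **Hankel matrices.** For $w=(w(0),\dots,w(T-1))$ with $w(t)\in\mathbb{R}^q$ and $1\le k\le T$, $\mathcal{H}_k(w)$ is the $qk\times(T-k+1)$ matrix whose $j$-th column ($j=0,\dots,T-k$) is $(w(j),w(j+1),\dots,w(j+k-1))$. *)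

theory Defs
  imports "Jordan_Normal_Form.Matrix" "Jordan_Normal_Form.DL_Rank"
begin

type_synonym signal = "nat \<Rightarrow> real vec"
type_synonym behavior = "(signal \<times> signal) set"

definition ss_behavior ::
  "nat \<Rightarrow> nat \<Rightarrow> nat \<Rightarrow> real mat \<Rightarrow> real mat \<Rightarrow> real mat \<Rightarrow> real mat \<Rightarrow> behavior" where
  "ss_behavior n m p A B C D =
     {(u, y). (\<forall>t. u t \<in> carrier_vec m) \<and> (\<forall>t. y t \<in> carrier_vec p) \<and>
        (\<exists>x :: signal. (\<forall>t. x t \<in> carrier_vec n) \<and>
           (\<forall>t. x (t + 1) = A *\<^sub>v x t + B *\<^sub>v u t \<and>
                y t = C *\<^sub>v x t + D *\<^sub>v u t))}"

definition ss_representation ::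
  "nat \<Rightarrow> nat \<Rightarrow> behavior \<Rightarrow> nat \<Rightarrow> real mat \<Rightarrow> real mat \<Rightarrow> real mat \<Rightarrow> real mat \<Rightarrow> bool" where
  "ss_representation m p \<B> n A B C D \<longleftrightarrow>
     A \<in> carrier_mat n n \<and> B \<in> carrier_mat n m \<and>
     C \<in> carrier_mat p n \<and> D \<in> carrier_mat p m \<and>
     \<B> = ss_behavior n m p A B C D"

definition LTI :: "nat \<Rightarrow> nat \<Rightarrow> behavior set" where
  "LTI m p = {\<B>. \<exists>n A B C D. ss_representation m p \<B> n A B C D}"

definition state_dim :: "nat \<Rightarrow> nat \<Rightarrow> behavior \<Rightarrow> nat" where
  "state_dim m p \<B> = (LEAST n. \<exists>A B C D. ss_representation m p \<B> n A B C D)"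

definition minimal_representation ::
  "nat \<Rightarrow> nat \<Rightarrow> behavior \<Rightarrow> nat \<Rightarrow> real mat \<Rightarrow> real mat \<Rightarrow> real mat \<Rightarrow> real mat \<Rightarrow> bool" where
  "minimal_representation m p \<B> n A B C D \<longleftrightarrow>
     ss_representation m p \<B> n A B C D \<and> n = state_dim m p \<B>"

primrec obs_mat :: "nat \<Rightarrow> real mat \<Rightarrow> real mat \<Rightarrow> nat \<Rightarrow> real mat" where
  "obs_mat n A C 0 = 0\<^sub>m 0 n"
| "obs_mat n A C (Suc k) = obs_mat n A C k @\<^sub>r (C * (A ^\<^sub>m k))"

(* p * k is the number of rows of the observability matrix *)
definition obs_rank :: "nat \<Rightarrow> nat \<Rightarrow> real mat \<Rightarrow> real mat \<Rightarrow> nat \<Rightarrow> nat" where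
  "obs_rank p n A C k = vec_space.rank (p * k) (obs_mat n A C k)"

(* The value does not depend on the chosen minimal representation: the column space of
   the k-th observability matrix consists of the output restrictions to [0, k-1] of the
   zero-input trajectories of the behavior. *)
definition lag :: "nat \<Rightarrow> nat \<Rightarrow> behavior \<Rightarrow> nat" where
  "lag m p \<B> = (SOME l. \<exists>n A B C D. minimal_representation m p \<B> n A B C D \<and>
     l = (LEAST k. obs_rank p n A C k = obs_rank p n A C (k + 1)))"

definition stack :: "real vec list \<Rightarrow> real vec" where
  "stack ws = foldr (@\<^sub>v) ws vNil"

(* Integer bounds, so that [0, T - 1] is the empty window when T = 0. *)
definition window :: "int \<Rightarrow> int \<Rightarrow> signal \<Rightarrow> real vec" where
  "window t0 t1 w = stack (map (\<lambda>t. w (nat t)) [t0..t1])"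

definition restriction :: "int \<Rightarrow> int \<Rightarrow> behavior \<Rightarrow> real vec set" where
  "restriction t0 t1 \<B> = {window t0 t1 u @\<^sub>v window t0 t1 y | u y. (u, y) \<in> \<B>}"

definition model_class :: "nat \<Rightarrow> nat \<Rightarrow> nat \<Rightarrow> nat \<Rightarrow> behavior set" where
  "model_class m p L N = {\<B> \<in> LTI m p. lag m p \<B> \<le> L \<and> state_dim m p \<B> \<le> N}"

(* Finite data are lists of samples; u and y are meant to have the same length T. *)
definition explaining ::
  "nat \<Rightarrow> nat \<Rightarrow> nat \<Rightarrow> nat \<Rightarrow> real vec list \<Rightarrow> real vec list \<Rightarrow> behavior set" where
  "explaining m p L N u y =
     {\<B> \<in> model_class m p L N. stack u @\<^sub>v stack y \<in> restriction 0 (int (length u) - 1) \<B>}"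

definition hankel :: "nat \<Rightarrow> nat \<Rightarrow> real vec list \<Rightarrow> real mat" where
  "hankel q k w =
     mat_of_cols (q * k) (map (\<lambda>j. stack (take k (drop j w))) [0..<length w - k + 1])"

definition mat_im :: "real mat \<Rightarrow> real vec set" where
  "mat_im M = (\<lambda>v. M *\<^sub>v v) ` carrier_vec (dim_col M)"

end

theory Submission
  imports Defs
begin

text \<open>Fix an explaining system. Its behavior contains an infinite trajectory whose first T
  samples are the data (\<open>restriction_samples\<close>). Behaviors are time-invariant
  (\<open>LTI_shift\<close>), so every shift of this trajectory is again a trajectory. For 0 \<le> j
  \<le> T - k, the first k samples of the shift by j still lie inside the data, and stacked they
  form exactly the j-th column of the stacked Hankel matrix (\<open>col_hankel\<close>,
  \<open>col_append_rows\<close>). Hence every column lies in the restricted behavior.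

  Behaviors are also linear (\<open>LTI_zero\<close>, \<open>LTI_add\<close>,
  \<open>LTI_smult\<close>), and taking windows is a linear map, so the restricted behavior is a
  subspace. A subspace that contains all columns of a matrix contains its image
  (\<open>mult_mat_vec_mem_of_cols\<close>). The explaining system was arbitrary, so the image lies
  in the intersection.\<close>

section \<open>Linear algebra: images and column spans\<close>

lemma append_vec_smult:
  fixes a :: "'a :: semiring_0"
  shows "a \<cdot>\<^sub>v (v @\<^sub>v w) = (a \<cdot>\<^sub>v v) @\<^sub>v (a \<cdot>\<^sub>v w)"
  by (intro eq_vecI) auto

text \<open>A matrix-vector product is a linear combination of the columns, and the closure
  conditions make \<open>S\<close> a submodule, which contains the span of any of its subsets. This
  reduces an inclusion of an image to a check on single columns.\<close>

lemma mult_mat_vec_mem_of_cols: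
  fixes M :: "'a :: field mat"
  assumes M: "M \<in> carrier_mat n c" and v: "v \<in> carrier_vec c"
    and sub: "S \<subseteq> carrier_vec n"
    and zero: "0\<^sub>v n \<in> S"
    and add: "\<And>a b. a \<in> S \<Longrightarrow> b \<in> S \<Longrightarrow> a + b \<in> S"
    and smult: "\<And>r a. a \<in> S \<Longrightarrow> r \<cdot>\<^sub>v a \<in> S"
    and cols: "\<And>j. j < c \<Longrightarrow> col M j \<in> S"
  shows "M *\<^sub>v v \<in> S"
proof -
  interpret vec_space "TYPE('a)" n .
  have "submodule class_ring S (module_vec TYPE('a) n)"
    using sub zero add smult
    by unfold_locales (auto simp: module_vec_simps)
  moreover have "set (Matrix.cols M) \<subseteq> S"
    using M cols by (auto simp: Matrix.cols_def)
  ultimately have "col_space M \<subseteq> S"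
    unfolding col_space_def by (intro span_is_subset)
  moreover have "M *\<^sub>v v \<in> col_space M"
    using M v by (auto simp: col_space_eq[OF M])
  ultimately show ?thesis by blast
qed

section \<open>Stacked vectors and windows\<close>

lemma stack_simps [simp]:
  "stack [] = vNil" "stack (w # ws) = w @\<^sub>v stack ws"
  by (simp_all add: stack_def)

lemma stack_carrier:
  "set ws \<subseteq> carrier_vec q \<Longrightarrow> stack ws \<in> carrier_vec (q * length ws)"
  by (induction ws) auto

text \<open>Blocks of a known common size \<open>q\<close> can be cut off one by one. The equal
  lengths have to be assumed because for \<open>q = 0\<close> all lists stack to the empty
  vector.\<close>

lemma stack_inject:
  assumes "length vs = length ws"
    and "set vs \<subseteq> carrier_vec q" and "set ws \<subseteq> carrier_vec q"
    and "stack vs = stack ws"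
  shows "vs = ws"
  using assms
proof (induction vs ws rule: list_induct2)
  case (Cons v vs w ws)
  then show ?case
    using append_vec_eq[of v q w "stack vs" "stack ws"] by auto
qed simp

lemma stack_zero: "stack (map (\<lambda>t. 0\<^sub>v q) ts) = 0\<^sub>v (q * length ts)"
  by (induction ts) (auto intro!: eq_vecI)

lemma stack_add:
  assumes "\<And>t. f t \<in> carrier_vec q" and "\<And>t. g t \<in> carrier_vec q"
  shows "stack (map (\<lambda>t. f t + g t) ts) = stack (map f ts) + stack (map g ts)"
proof (induction ts)
  case (Cons t ts)
  \<comment> \<open>Addition splits over an append only when the blocks have matching dimensions;
    the generic \<open>h\<close> covers both \<open>f\<close> and \<open>g\<close>.\<close>
  have "stack (map h ts) \<in> carrier_vec (q * length ts)"
    if "\<And>t. h t \<in> carrier_vec q" for h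
    using stack_carrier[of "map h ts" q] that by auto
  with Cons assms show ?case by (simp add: append_vec_add[of _ q _ _ "q * length ts"])
qed auto

lemma stack_smult: "stack (map (\<lambda>t. r \<cdot>\<^sub>v f t) ts) = r \<cdot>\<^sub>v stack (map f ts)"
  by (induction ts) (auto simp: append_vec_smult)

text \<open>Replaces the integer interval by a list of naturals; for \<open>k = 0\<close> both sides
  are the empty stack.\<close>

lemma window_eq_stack: "window 0 (int k - 1) w = stack (map w [0..<k])"
proof -
  have "[0..int k - 1] = map int [0..<k]"
    by (intro nth_equalityI) auto
  then show ?thesis by (simp add: window_def comp_def)
qed

lemma window_carrier:
  "(\<And>t. w t \<in> carrier_vec q) \<Longrightarrow> window 0 (int k - 1) w \<in> carrier_vec (q * k)"
  using stack_carrier[of "map w [0..<k]" q] by (auto simp: window_eq_stack)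

section \<open>LTI behaviors are shift-invariant and linear\<close>

lemma ss_behaviorE:
  assumes "(u, y) \<in> ss_behavior n m p A B C D"
  obtains x where "\<And>t. u t \<in> carrier_vec m" "\<And>t. y t \<in> carrier_vec p"
    "\<And>t. x t \<in> carrier_vec n" "\<And>t. x (Suc t) = A *\<^sub>v x t + B *\<^sub>v u t"
    "\<And>t. y t = C *\<^sub>v x t + D *\<^sub>v u t"
  using assms unfolding ss_behavior_def Suc_eq_plus1 by blast

lemma ss_behaviorI:
  assumes "\<And>t. u t \<in> carrier_vec m" "\<And>t. y t \<in> carrier_vec p"
    "\<And>t. x t \<in> carrier_vec n" "\<And>t. x (Suc t) = A *\<^sub>v x t + B *\<^sub>v u t"
    "\<And>t. y t = C *\<^sub>v x t + D *\<^sub>v u t"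
  shows "(u, y) \<in> ss_behavior n m p A B C D"
  using assms unfolding ss_behavior_def Suc_eq_plus1 by blast

lemma LTI_E:
  assumes "\<B> \<in> LTI m p"
  obtains n A B C D where "A \<in> carrier_mat n n" "B \<in> carrier_mat n m"
    "C \<in> carrier_mat p n" "D \<in> carrier_mat p m" "\<B> = ss_behavior n m p A B C D"
  using assms unfolding LTI_def ss_representation_def by blast

lemma LTI_carrier:
  assumes "\<B> \<in> LTI m p" and "(u, y) \<in> \<B>"
  shows "u t \<in> carrier_vec m" and "y t \<in> carrier_vec p"
  using assms unfolding LTI_def ss_representation_def ss_behavior_def by blast+

text \<open>The coefficient matrices are constant in time and the initial state is free, so the
  shifted state sequence, now starting in \<open>x j\<close>, witnesses the shifted
  trajectory.\<close>

lemma LTI_shift: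
  assumes "\<B> \<in> LTI m p" and "(u, y) \<in> \<B>"
  shows "(\<lambda>t. u (t + j), \<lambda>t. y (t + j)) \<in> \<B>"
proof -
  obtain n A B C D where \<B>: "\<B> = ss_behavior n m p A B C D"
    using assms(1) by (elim LTI_E)
  obtain x where "\<And>t. u t \<in> carrier_vec m" "\<And>t. y t \<in> carrier_vec p"
    "\<And>t. x t \<in> carrier_vec n" "\<And>t. x (Suc t) = A *\<^sub>v x t + B *\<^sub>v u t"
    "\<And>t. y t = C *\<^sub>v x t + D *\<^sub>v u t"
    using assms(2) unfolding \<B> by (rule ss_behaviorE) (rule that)
  then show ?thesis
    unfolding \<B> by (intro ss_behaviorI[where x = "\<lambda>t. x (t + j)"]) auto
qed

lemma LTI_zero:
  assumes "\<B> \<in> LTI m p"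
  shows "(\<lambda>t. 0\<^sub>v m, \<lambda>t. 0\<^sub>v p) \<in> \<B>"
proof -
  obtain n A B C D where "A \<in> carrier_mat n n" "B \<in> carrier_mat n m"
      "C \<in> carrier_mat p n" "D \<in> carrier_mat p m"
    and \<B>: "\<B> = ss_behavior n m p A B C D"
    using assms by (elim LTI_E)
  then show ?thesis
    unfolding \<B> by (intro ss_behaviorI[where x = "\<lambda>t. 0\<^sub>v n"]) auto
qed

lemma LTI_smult:
  assumes "\<B> \<in> LTI m p" and "(u, y) \<in> \<B>"
  shows "(\<lambda>t. r \<cdot>\<^sub>v u t, \<lambda>t. r \<cdot>\<^sub>v y t) \<in> \<B>"
proof -
  obtain n A B C D where mats: "A \<in> carrier_mat n n" "B \<in> carrier_mat n m"
      "C \<in> carrier_mat p n" "D \<in> carrier_mat p m"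
    and \<B>: "\<B> = ss_behavior n m p A B C D"
    using assms(1) by (elim LTI_E)
  obtain x where x: "\<And>t. u t \<in> carrier_vec m" "\<And>t. y t \<in> carrier_vec p"
    "\<And>t. x t \<in> carrier_vec n" "\<And>t. x (Suc t) = A *\<^sub>v x t + B *\<^sub>v u t"
    "\<And>t. y t = C *\<^sub>v x t + D *\<^sub>v u t"
    using assms(2) unfolding \<B> by (rule ss_behaviorE) (rule that)
  \<comment> \<open>The state and output equations have the same shape, so one identity with generic
    \<open>E\<close>, \<open>F\<close> serves for (A, B) and for (C, D).\<close>
  have lin: "r \<cdot>\<^sub>v (E *\<^sub>v x t + F *\<^sub>v u t) = E *\<^sub>v (r \<cdot>\<^sub>v x t) + F *\<^sub>v (r \<cdot>\<^sub>v u t)"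
    if "E \<in> carrier_mat d n" "F \<in> carrier_mat d m" for E F d t
    using that x(1,3)[of t]
    by (simp add: mult_mat_vec smult_add_distrib_vec[of _ d])
  show ?thesis
    unfolding \<B>
  proof (rule ss_behaviorI)
    show "r \<cdot>\<^sub>v x (Suc t) = A *\<^sub>v (r \<cdot>\<^sub>v x t) + B *\<^sub>v (r \<cdot>\<^sub>v u t)" for t
      using lin[OF mats(1,2)] by (simp add: x(4))
    show "r \<cdot>\<^sub>v y t = C *\<^sub>v (r \<cdot>\<^sub>v x t) + D *\<^sub>v (r \<cdot>\<^sub>v u t)" for t
      unfolding x(5) using lin[OF mats(3,4)] by simp
  qed (use x(1-3) in auto)
qed

lemma LTI_add:
  assumes "\<B> \<in> LTI m p" and "(u, y) \<in> \<B>" and "(u', y') \<in> \<B>"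
  shows "(\<lambda>t. u t + u' t, \<lambda>t. y t + y' t) \<in> \<B>"
proof -
  obtain n A B C D where mats: "A \<in> carrier_mat n n" "B \<in> carrier_mat n m"
      "C \<in> carrier_mat p n" "D \<in> carrier_mat p m"
    and \<B>: "\<B> = ss_behavior n m p A B C D"
    using assms(1) by (elim LTI_E)
  obtain x where x: "\<And>t. u t \<in> carrier_vec m" "\<And>t. y t \<in> carrier_vec p"
    "\<And>t. x t \<in> carrier_vec n" "\<And>t. x (Suc t) = A *\<^sub>v x t + B *\<^sub>v u t"
    "\<And>t. y t = C *\<^sub>v x t + D *\<^sub>v u t"
    using assms(2) unfolding \<B> by (rule ss_behaviorE) (rule that)
  obtain x' where x': "\<And>t. u' t \<in> carrier_vec m" "\<And>t. y' t \<in> carrier_vec p"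
    "\<And>t. x' t \<in> carrier_vec n" "\<And>t. x' (Suc t) = A *\<^sub>v x' t + B *\<^sub>v u' t"
    "\<And>t. y' t = C *\<^sub>v x' t + D *\<^sub>v u' t"
    using assms(3) unfolding \<B> by (rule ss_behaviorE) (rule that)
  \<comment> \<open>Again generic, for both system equations. After distributing, only a
    rearrangement of four summands is left, which is checked entrywise.\<close>
  have lin: "(E *\<^sub>v x t + F *\<^sub>v u t) + (E *\<^sub>v x' t + F *\<^sub>v u' t)
      = E *\<^sub>v (x t + x' t) + F *\<^sub>v (u t + u' t)"
    if E: "E \<in> carrier_mat d n" and F: "F \<in> carrier_mat d m" for E F d t
    unfolding mult_add_distrib_mat_vec[OF E x(3) x'(3)] mult_add_distrib_mat_vec[OF F x(1) x'(1)]
    using E F by (intro eq_vecI) auto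
  show ?thesis
    unfolding \<B>
  proof (rule ss_behaviorI)
    show "x (Suc t) + x' (Suc t) = A *\<^sub>v (x t + x' t) + B *\<^sub>v (u t + u' t)" for t
      using lin[OF mats(1,2)] by (simp add: x(4) x'(4))
    show "y t + y' t = C *\<^sub>v (x t + x' t) + D *\<^sub>v (u t + u' t)" for t
      unfolding x(5) x'(5) using lin[OF mats(3,4)] by simp
  qed (use x(1-3) x'(1-3) in auto)
qed

section \<open>Restricted behaviors are subspaces\<close>

lemma restrictionI:
  "(u, y) \<in> \<B> \<Longrightarrow> window t0 t1 u @\<^sub>v window t0 t1 y \<in> restriction t0 t1 \<B>"
  unfolding restriction_def by blast

lemma restrictionE:
  assumes "w \<in> restriction t0 t1 \<B>"
  obtains u y where "(u, y) \<in> \<B>" "w = window t0 t1 u @\<^sub>v window t0 t1 y"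
  using assms unfolding restriction_def by blast

text \<open>The four facts proved here are the subspace conditions that
  \<open>mult_mat_vec_mem_of_cols\<close> asks of \<open>S\<close>. Each one transfers a property of
  the behavior through the linear map that takes a trajectory to its stacked window.\<close>

context
  fixes \<B> m p
  assumes LTI: "\<B> \<in> LTI m p"
begin

lemma restriction_carrier:
  "restriction 0 (int k - 1) \<B> \<subseteq> carrier_vec (m * k + p * k)"
  using LTI_carrier[OF LTI] by (auto elim!: restrictionE intro!: append_carrier_vec window_carrier)

lemma restriction_zero: "0\<^sub>v (m * k + p * k) \<in> restriction 0 (int k - 1) \<B>"
proof -
  have "0\<^sub>v (m * k) @\<^sub>v 0\<^sub>v (p * k) = (0\<^sub>v (m * k + p * k) :: real vec)"
    by (intro eq_vecI) auto
  with restrictionI[OF LTI_zero[OF LTI], of 0 "int k - 1"] show ?thesis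
    using stack_zero[of m "[0..<k]"] stack_zero[of p "[0..<k]"]
    by (simp add: window_eq_stack)
qed

lemma restriction_smult:
  assumes "w \<in> restriction 0 (int k - 1) \<B>"
  shows "r \<cdot>\<^sub>v w \<in> restriction 0 (int k - 1) \<B>"
proof -
  from assms obtain u y where "(u, y) \<in> \<B>"
    and "w = window 0 (int k - 1) u @\<^sub>v window 0 (int k - 1) y"
    by (elim restrictionE)
  with restrictionI[OF LTI_smult[OF LTI this(1), of r], of 0 "int k - 1"] show ?thesis
    by (simp add: window_eq_stack stack_smult append_vec_smult)
qed

lemma restriction_add:
  assumes "w \<in> restriction 0 (int k - 1) \<B>" and "w' \<in> restriction 0 (int k - 1) \<B>"
  shows "w + w' \<in> restriction 0 (int k - 1) \<B>"
proof -
  from assms(1) obtain u y where uy: "(u, y) \<in> \<B>"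
    and w: "w = window 0 (int k - 1) u @\<^sub>v window 0 (int k - 1) y"
    by (elim restrictionE)
  from assms(2) obtain u' y' where uy': "(u', y') \<in> \<B>"
    and w': "w' = window 0 (int k - 1) u' @\<^sub>v window 0 (int k - 1) y'"
    by (elim restrictionE)
  note c = LTI_carrier[OF LTI uy] and c' = LTI_carrier[OF LTI uy']
  have "window 0 (int k - 1) (\<lambda>t. u t + u' t) @\<^sub>v window 0 (int k - 1) (\<lambda>t. y t + y' t) = w + w'"
    unfolding w w' using window_carrier[of _ m k] window_carrier[of _ p k] c c'
    by (simp add: append_vec_add[of _ "m * k" _ _ "p * k"]
        window_eq_stack stack_add[of _ m] stack_add[of _ p])
  with restrictionI[OF LTI_add[OF LTI uy uy'], of 0 "int k - 1"] show ?thesis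
    by simp
qed

end

text \<open>Decodes the stacked data vector: the input part has \<open>m * T\<close> entries on both
  sides, so the cut between inputs and outputs is unique, and then \<open>stack_inject\<close>
  recovers the samples. The data thereby become the initial segment of an infinite trajectory, which
  can be shifted.\<close>

lemma restriction_samples:
  assumes LTI: "\<B> \<in> LTI m p"
    and u: "length u = T" "set u \<subseteq> carrier_vec m"
    and y: "length y = T" "set y \<subseteq> carrier_vec p"
    and mem: "stack u @\<^sub>v stack y \<in> restriction 0 (int T - 1) \<B>"
  obtains u' y' where "(u', y') \<in> \<B>" "u = map u' [0..<T]" "y = map y' [0..<T]"
proof -
  from mem obtain u' y' where uy': "(u', y') \<in> \<B>"
    and eq: "stack u @\<^sub>v stack y = stack (map u' [0..<T]) @\<^sub>v stack (map y' [0..<T])"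
    by (auto elim!: restrictionE simp: window_eq_stack)
  note c = LTI_carrier[OF LTI uy']
  have "stack (map u' [0..<T]) \<in> carrier_vec (m * T)"
    using stack_carrier[of "map u' [0..<T]" m] c by auto
  moreover have "stack u \<in> carrier_vec (m * T)"
    using stack_carrier u by blast
  ultimately have "stack u = stack (map u' [0..<T])" "stack y = stack (map y' [0..<T])"
    using eq append_vec_eq by blast+
  then have "u = map u' [0..<T]" "y = map y' [0..<T]"
    using u y c by (auto intro!: stack_inject)
  with uy' that show thesis by blast
qed

section \<open>Columns of Hankel matrices\<close>

lemma hankel_carrier: "hankel q k w \<in> carrier_mat (q * k) (length w - k + 1)"
  by (rule carrier_matI) (simp_all add: hankel_def)

text \<open>The bound \<open>j + k \<le> T\<close> means that \<open>take\<close> finds all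
  \<open>k\<close> samples in the data, so the column is a full window of the signal shifted by
  \<open>j\<close>.\<close>

lemma col_hankel:
  assumes "j + k \<le> T" and "\<And>t. f t \<in> carrier_vec q"
  shows "col (hankel q k (map f [0..<T])) j = window 0 (int k - 1) (\<lambda>t. f (t + j))"
proof -
  have *: "take k (drop j (map f [0..<T])) = map (\<lambda>t. f (t + j)) [0..<k]"
    using assms(1) by (intro nth_equalityI) (auto simp: add.commute)
  have "col (hankel q k (map f [0..<T])) j = stack (take k (drop j (map f [0..<T])))"
    unfolding hankel_def using assms window_carrier[of "\<lambda>t. f (t + j)" q k]
    by (subst col_mat_of_cols) (auto simp: * window_eq_stack simp del: upt_Suc)
  then show ?thesis by (simp add: * window_eq_stack)
qed

lemma col_append_rows:
  assumes "A \<in> carrier_mat a c" and "B \<in> carrier_mat b c" and "j < c"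
  shows "col (A @\<^sub>r B) j = col A j @\<^sub>v col B j"
  using assms by (intro eq_vecI) (auto simp: append_rows_def)

theorem lemma5:
  fixes m p L N T :: nat and \<B>\<^sub>s :: behavior and u y :: "real vec list"
  assumes "\<B>\<^sub>s \<in> LTI m p"
    and "lag m p \<B>\<^sub>s \<le> L"
    and "state_dim m p \<B>\<^sub>s \<le> N"
    and "length u = T" and "set u \<subseteq> carrier_vec m"
    and "length y = T" and "set y \<subseteq> carrier_vec p"
    and "stack u @\<^sub>v stack y \<in> restriction 0 (int T - 1) \<B>\<^sub>s"
  shows "\<forall>k. 1 \<le> k \<and> k \<le> T \<longrightarrow>
           mat_im (hankel m k u @\<^sub>r hankel p k y)
             \<subseteq> (\<Inter>\<B> \<in> explaining m p L N u y. restriction 0 (int k - 1) \<B>)"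
proof (intro allI impI subsetI INT_I)
  fix k w \<B>
  assume k: "1 \<le> k \<and> k \<le> T"
    and w: "w \<in> mat_im (hankel m k u @\<^sub>r hankel p k y)"
    and \<B>: "\<B> \<in> explaining m p L N u y"
  let ?c = "T - k + 1"
  have LTI: "\<B> \<in> LTI m p"
    using \<B> by (simp add: explaining_def model_class_def)
  have "stack u @\<^sub>v stack y \<in> restriction 0 (int T - 1) \<B>"
    using \<B> assms(4) by (simp add: explaining_def)
  \<comment> \<open>This trajectory depends on the explaining system; it is tied to the data only on
    the first \<open>T\<close> samples.\<close>
  then obtain u' y' where uy': "(u', y') \<in> \<B>"
    and u: "u = map u' [0..<T]" and y: "y = map y' [0..<T]"
    using restriction_samples[OF LTI assms(4-7)] by blast
  note c = LTI_carrier[OF LTI uy']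
  have H: "hankel m k u \<in> carrier_mat (m * k) ?c" "hankel p k y \<in> carrier_mat (p * k) ?c"
    using hankel_carrier[of m k u] hankel_carrier[of p k y] assms(4,6) by auto
  have HH: "hankel m k u @\<^sub>r hankel p k y \<in> carrier_mat (m * k + p * k) ?c"
    using H by (rule carrier_append_rows)
  have cols: "col (hankel m k u @\<^sub>r hankel p k y) j \<in> restriction 0 (int k - 1) \<B>"
    if "j < ?c" for j
  proof -
    \<comment> \<open>Here \<open>k \<le> T\<close> matters: subtraction on naturals is truncated,
      so for larger \<open>k\<close> the count \<open>T - k + 1\<close> would still admit the column
      index 0.\<close>
    have "j + k \<le> T" using that k by linarith
    then show ?thesis
      using restrictionI[OF LTI_shift[OF LTI uy', of j], of 0 "int k - 1"]
      unfolding col_append_rows[OF H that] by (simp add: u y col_hankel c)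
  qed
  from w HH obtain v where v: "v \<in> carrier_vec ?c"
    and "w = (hankel m k u @\<^sub>r hankel p k y) *\<^sub>v v"
    by (auto simp: mat_im_def)
  \<comment> \<open>The restricted behavior is a subspace containing all columns, hence also their
    combination with coefficients \<open>v\<close>.\<close>
  then show "w \<in> restriction 0 (int k - 1) \<B>"
    using mult_mat_vec_mem_of_cols[OF HH v restriction_carrier[OF LTI] restriction_zero[OF LTI]
        restriction_add[OF LTI] restriction_smult[OF LTI] cols]
    by simp
qed

end
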